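(* Any algorithm for the Max Cover problem which satisfies $\epsilon$-edge differential privacy must incur an additive error of $\Omega(k\log(n/k)/\epsilon)$; that is, no $\epsilon$-edge differentially private algorithm can guarantee, on all Max Cover instances with $n$ elements and parameter $k$, to output $k$ sets whose union has size at least $\mathrm{OPT}-o(k\log(n/k)/\epsilon)$.
   Context: Max Cover: given a universe $\mathcal{U}$ of $n$ elements, a set system $\mathcal{S}$ of subsets of $\mathcal{U}$, and $k\in\mathbb{N}$, choose $k$ sets of $\mathcal{S}$ maximizing the size of their union; $\mathrm{OPT}$ denotes this maximum. Edge-neighbors: for a fixed universe $\mathcal{U}$, two set systems are edge-neighbors if they differ in exactly one set, and that set differs by exactly one element. A randomized mechanism $\mathcal{M}$ on set systems is $\epsilon$-edge differentially private if for all edge-neighbors $\mathcal{S}_1,\mathcal{S}_2$ and all measurable output sets $Y$, $\Pr[\mathcal{M}(\mathcal{S}_1)\in Y]\le e^{\epsilon}\Pr[\mathcal{M}(\mathcal{S}_2)\in Y]$.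
   Formalization: The error bound is capped: Ω(min(n, k log(n/k)/ε)) instead of Ω(k log(n/k)/ε), since the additive error never exceeds OPT ≤ n and the uncapped bound fails as ε tends to 0. *)

theory Defs
  imports "HOL-Probability.Probability_Mass_Function"
begin

text \<open>
  A set system over the universe \<open>U\<close> is an indexed family \<open>S!0, \<dots>, S!(m-1)\<close> of subsets of \<open>U\<close>,
  equivalently a bipartite graph between \<open>m\<close> set nodes and the elements of \<open>U\<close>; different
  indices may carry equal sets. An edge-neighbor is obtained by adding or deleting one edge of
  this graph.
\<close>

definition set_system :: "'a set \<Rightarrow> 'a set list \<Rightarrow> bool" where
  "set_system U S \<longleftrightarrow> (\<forall>A \<in> set S. A \<subseteq> U)"

definition edge_neighbors :: "'a set \<Rightarrow> 'a set list \<Rightarrow> 'a set list \<Rightarrow> bool" where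
  "edge_neighbors U S1 S2 \<longleftrightarrow>
     set_system U S1 \<and> set_system U S2 \<and> length S1 = length S2 \<and>
     (\<exists>i < length S1.
        (\<forall>j < length S1. j \<noteq> i \<longrightarrow> S1 ! j = S2 ! j) \<and>
        (\<exists>x. (S1 ! i - S2 ! i) \<union> (S2 ! i - S1 ! i) = {x}))"

definition edge_dp :: "'a set \<Rightarrow> real \<Rightarrow> ('a set list \<Rightarrow> 'b pmf) \<Rightarrow> bool" where
  "edge_dp U \<epsilon> M \<longleftrightarrow>
     (\<forall>S1 S2 Y. edge_neighbors U S1 S2 \<longrightarrow>
        measure_pmf.prob (M S1) Y \<le> exp \<epsilon> * measure_pmf.prob (M S2) Y)"

definition k_choices :: "nat \<Rightarrow> 'a set list \<Rightarrow> nat set set" where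
  "k_choices k S = {I. I \<subseteq> {..<length S} \<and> card I = k}"

definition coverage :: "'a set list \<Rightarrow> nat set \<Rightarrow> nat" where
  "coverage S I = card (\<Union>i\<in>I. S ! i)"

text \<open>\<open>Max\<close> is meaningful here only for \<open>k \<le> length S\<close>: otherwise there is no choice of \<open>k\<close> sets.\<close>

definition max_cover_instance :: "'a set \<Rightarrow> nat \<Rightarrow> 'a set list \<Rightarrow> bool" where
  "max_cover_instance U k S \<longleftrightarrow> set_system U S \<and> k \<le> length S"

definition OPT :: "nat \<Rightarrow> 'a set list \<Rightarrow> nat" where
  "OPT k S = Max (coverage S ` k_choices k S)"

text \<open>
  A randomized algorithm reports the chosen sets by their indices. (If it had to report the
  chosen subsets of \<open>U\<close> themselves, no private algorithm would exist, because every set of the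
  input can be replaced in an edge-neighbor.) The output space is countable, hence a \<open>pmf\<close>.
\<close>

definition max_cover_algorithm :: "'a set \<Rightarrow> nat \<Rightarrow> ('a set list \<Rightarrow> nat set pmf) \<Rightarrow> bool" where
  "max_cover_algorithm U k M \<longleftrightarrow>
     (\<forall>S. max_cover_instance U k S \<longrightarrow> set_pmf (M S) \<subseteq> k_choices k S)"

end

theory Submission
  imports Defs
begin

text \<open>
  Take \<open>m\<close> sets and \<open>k\<close> disjoint blocks of \<open>b\<close> elements each, and hand block \<open>j\<close> to the set with
  index \<open>f j\<close>, for a function \<open>f\<close> from the blocks to the indices; then \<open>k\<close> sets cover all \<open>k b\<close>
  elements. The instance is \<open>k b\<close> edges away from the instance of \<open>m\<close> empty sets, which does not
  depend on \<open>f\<close>. For a fixed output \<open>J\<close> of \<open>k\<close> indices, a Chernoff bound shows that \<open>J\<close> contains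
  \<open>f j\<close> for at least half of the blocks \<open>j\<close> for at most a fraction \<open>(4 k / m) powr (k / 2)\<close> of all
  \<open>f\<close>. Hence, when \<open>exp (\<epsilon> b)\<close> is at most a quarter of \<open>sqrt (m / k)\<close>, averaging over \<open>f\<close> yields
  an instance on which, with probability at least one half, half of the \<open>k b\<close> elements are missed.
  With \<open>m\<close> about \<open>16 n exp (2 \<epsilon>)\<close> one can afford \<open>b\<close> about \<open>1 + ln (n / k) / (2 \<epsilon>)\<close>, capped by
  \<open>n / k\<close>.
\<close>

section \<open>Instances that assign elements to set indices\<close>

text \<open>The set \<open>V\<close> of elements handed out is a separate parameter: enlarging it by
  one element adds a single edge, and the empty \<open>V\<close> gives an instance independent of
  \<open>g\<close>.\<close>

definition assignment_system :: "nat \<Rightarrow> 'a set \<Rightarrow> ('a \<Rightarrow> nat) \<Rightarrow> 'a set list" where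
  "assignment_system m V g = map (\<lambda>i. {x \<in> V. g x = i}) [0..<m]"

lemma length_assignment_system [simp]: "length (assignment_system m V g) = m"
  by (simp add: assignment_system_def)

lemma nth_assignment_system [simp]:
  "i < m \<Longrightarrow> assignment_system m V g ! i = {x \<in> V. g x = i}"
  by (simp add: assignment_system_def)

lemma set_system_assignment_system: "V \<subseteq> U \<Longrightarrow> set_system U (assignment_system m V g)"
  by (auto simp: set_system_def assignment_system_def)

lemma assignment_system_empty: "assignment_system m {} g = replicate m {}"
  by (simp add: assignment_system_def map_replicate_const)

lemma edge_neighbors_assignment_system_insert:
  assumes "insert x V \<subseteq> U" "x \<notin> V" "g x < m"
  shows "edge_neighbors U (assignment_system m (insert x V) g) (assignment_system m V g)"
  unfolding edge_neighbors_def
proof (intro conjI exI[of _ "g x"] allI impI)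
  show "set_system U (assignment_system m (insert x V) g)" "set_system U (assignment_system m V g)"
    using assms by (intro set_system_assignment_system; simp)+
  have "{y \<in> insert x V. g y = g x} - {y \<in> V. g y = g x} \<union>
      ({y \<in> V. g y = g x} - {y \<in> insert x V. g y = g x}) = {x}"
    using assms by auto
  then show "\<exists>z. assignment_system m (insert x V) g ! g x - assignment_system m V g ! g x \<union>
      (assignment_system m V g ! g x - assignment_system m (insert x V) g ! g x) = {z}"
    using assms by auto
qed (use assms in auto)

text \<open>Group privacy: handing out the elements of \<open>V\<close> one at a time costs a factor
  \<open>exp \<epsilon>\<close> per edge.\<close>

lemma edge_dp_assignment_system:
  assumes "edge_dp U \<epsilon> M" "finite V" "V \<subseteq> U" "g ` V \<subseteq> {..<m}"
  shows "measure_pmf.prob (M (assignment_system m V g)) Y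
    \<le> exp (\<epsilon> * real (card V)) * measure_pmf.prob (M (replicate m {})) Y"
  using assms(2-4)
proof (induction V rule: finite_induct)
  case empty
  then show ?case by (simp add: assignment_system_empty)
next
  case (insert x V)
  have "measure_pmf.prob (M (assignment_system m (insert x V) g)) Y
      \<le> exp \<epsilon> * measure_pmf.prob (M (assignment_system m V g)) Y"
    using assms(1) edge_neighbors_assignment_system_insert[of x V U g m] insert
    by (auto simp: edge_dp_def)
  also have "\<dots> \<le> exp \<epsilon> * (exp (\<epsilon> * real (card V)) * measure_pmf.prob (M (replicate m {})) Y)"
    using insert by (intro mult_left_mono) auto
  also have "\<dots> = exp (\<epsilon> * real (card (insert x V))) * measure_pmf.prob (M (replicate m {})) Y"
    using insert by (simp add: algebra_simps exp_add)
  finally show ?case .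
qed

lemma coverage_assignment_system:
  assumes "J \<subseteq> {..<m}"
  shows "coverage (assignment_system m V g) J = card {x \<in> V. g x \<in> J}"
proof -
  have "(\<Union>i\<in>J. assignment_system m V g ! i) = (\<Union>i\<in>J. {x \<in> V. g x = i})"
    using assms by (intro SUP_cong) auto
  also have "\<dots> = {x \<in> V. g x \<in> J}"
    by auto
  finally show ?thesis
    by (simp add: coverage_def)
qed

text \<open>The image of \<open>V\<close> under \<open>g\<close>, padded to exactly \<open>k\<close>
  indices, covers all of \<open>V\<close>; the padding is possible because
  \<open>k \<le> m\<close>.\<close>

lemma card_le_OPT_assignment_system:
  assumes "g ` V \<subseteq> {..<m}" "card (g ` V) \<le> k" "k \<le> m"
  shows "card V \<le> OPT k (assignment_system m V g)"
proof -
  let ?S = "assignment_system m V g"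
  obtain I where I: "g ` V \<subseteq> I" "I \<subseteq> {..<m}" "card I = k"
    using exists_subset_between[of "g ` V" k "{..<m}"] assms by auto
  have "I \<in> k_choices k ?S"
    using I by (simp add: k_choices_def)
  moreover have "finite (k_choices k ?S)"
    by (rule finite_subset[of _ "Pow {..<m}"]) (auto simp: k_choices_def)
  ultimately have "coverage ?S I \<le> OPT k ?S"
    by (simp add: OPT_def)
  moreover have "{x \<in> V. g x \<in> I} = V"
    using I by auto
  ultimately show ?thesis
    using I by (simp add: coverage_assignment_system)
qed

section \<open>Blocks of equal size\<close>

text \<open>The block number \<open>p\<close> is the first coordinate of a bijection from
  \<open>V\<close> to a \<open>k\<close> by \<open>b\<close> grid.\<close>

lemma obtain_equal_blocks:
  assumes "finite U" "k * b \<le> card U"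
  obtains V and p :: "'a \<Rightarrow> nat"
  where "V \<subseteq> U" "p ` V \<subseteq> {..<k}" "\<And>j. j < k \<Longrightarrow> card {x \<in> V. p x = j} = b"
proof -
  obtain V where V: "V \<subseteq> U" "card V = k * b" "finite V"
    using obtain_subset_with_card_n[OF assms(2)] by metis
  then obtain h where h: "bij_betw h V ({..<k} \<times> {..<b})"
    using finite_same_card_bij[of V "{..<k} \<times> {..<b}"] by (auto simp: card_cartesian_product)
  have "card {x \<in> V. (fst \<circ> h) x = j} = b" if "j < k" for j
  proof -
    have "bij_betw h {x \<in> V. (fst \<circ> h) x = j} ({j} \<times> {..<b})"
    proof (rule bij_betw_subset[OF h])
      show "h ` {x \<in> V. (fst \<circ> h) x = j} = {j} \<times> {..<b}"
      proof (intro equalityI subsetI)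
        fix z assume "z \<in> {j} \<times> {..<b}"
        then have "z \<in> h ` V" "fst z = j"
          using that bij_betw_imp_surj_on[OF h] by auto
        then show "z \<in> h ` {x \<in> V. (fst \<circ> h) x = j}"
          by auto
      qed (use bij_betw_apply[OF h] in \<open>auto simp: mem_Times_iff\<close>)
    qed auto
    then show ?thesis
      by (auto dest: bij_betw_same_card simp: card_cartesian_product)
  qed
  moreover have "(fst \<circ> h) ` V \<subseteq> {..<k}"
    using bij_betw_apply[OF h] by (simp add: image_subset_iff mem_Times_iff)
  ultimately show thesis
    using that V by blast
qed

lemma card_preimage_equal_blocks:
  assumes "finite V" "p ` V \<subseteq> {..<k}" "\<And>j. j < k \<Longrightarrow> card {x \<in> V. p x = j} = b"
  shows "card {x \<in> V. P (p x)} = b * card {j. j < (k::nat) \<and> P j}"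
proof -
  have "{x \<in> V. P (p x)} = (\<Union>j\<in>{j. j < k \<and> P j}. {x \<in> V. p x = j})"
    using assms(2) by auto
  also have "card \<dots> = (\<Sum>j\<in>{j. j < k \<and> P j}. card {x \<in> V. p x = j})"
    using assms(1) by (intro card_UN_disjoint) auto
  also have "\<dots> = b * card {j. j < k \<and> P j}"
    using assms(3) by simp
  finally show ?thesis .
qed

text \<open>Markov's inequality for \<open>s ^ (2 * hits)\<close>, whose mean is at most \<open>2 ^ k\<close> because
  \<open>card J * s\<^sup>2 \<le> m\<close>.\<close>

lemma card_functions_hitting_half:
  assumes J: "J \<subseteq> {..<m}" and s: "1 \<le> s" "real (card J) * s\<^sup>2 \<le> real m"
  shows "real (card {f \<in> {..<k} \<rightarrow>\<^sub>E {..<m}. k \<le> 2 * card {j. j < k \<and> f j \<in> J}}) * s ^ k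
    \<le> (2 * real m) ^ k"
proof -
  let ?F = "{..<k} \<rightarrow>\<^sub>E {..<m}"
  let ?h = "\<lambda>f. card {j. j < k \<and> f j \<in> J}"
  have fin: "finite ?F"
    by (simp add: finite_PiE)
  \<comment> \<open>Weighting every hit by \<open>s\<^sup>2\<close> makes the weight a product over
    the blocks, so its sum over all functions factors into a \<open>k\<close>-th power.\<close>
  have prod_eq: "(\<Prod>j<k. if f j \<in> J then s\<^sup>2 else 1) = s ^ (2 * ?h f)" for f
    by (simp add: prod.If_cases power_mult Int_def)
  have "real (card {f \<in> ?F. k \<le> 2 * ?h f}) * s ^ k = (\<Sum>f | f \<in> ?F \<and> k \<le> 2 * ?h f. s ^ k)"
    by simp
  also have "\<dots> \<le> (\<Sum>f | f \<in> ?F \<and> k \<le> 2 * ?h f. s ^ (2 * ?h f))"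
    using s by (intro sum_mono power_increasing) auto
  also have "\<dots> \<le> (\<Sum>f\<in>?F. s ^ (2 * ?h f))"
    using s fin by (intro sum_mono2) auto
  also have "\<dots> = (\<Sum>f\<in>?F. \<Prod>j<k. if f j \<in> J then s\<^sup>2 else 1)"
    by (simp only: prod_eq)
  also have "\<dots> = (\<Prod>j<k. \<Sum>i<m. if i \<in> J then s\<^sup>2 else 1)"
    by (rule prod_sum_PiE[symmetric]) auto
  also have "\<dots> = (\<Sum>i<m. if i \<in> J then s\<^sup>2 else 1) ^ k"
    by simp
  also have "\<dots> \<le> (2 * real m) ^ k"
  proof (rule power_mono)
    have "(\<Sum>i<m. if i \<in> J then s\<^sup>2 else 1) \<le> (\<Sum>i<m. (if i \<in> J then s\<^sup>2 else 0) + 1)"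
      by (intro sum_mono) auto
    also have "\<dots> = real (card J) * s\<^sup>2 + real m"
      using J by (simp add: sum.distrib sum.If_cases Int_absorb1)
    finally show "(\<Sum>i<m. if i \<in> J then s\<^sup>2 else 1) \<le> 2 * real m"
      using s by simp
  qed (auto intro!: sum_nonneg)
  finally show ?thesis .
qed

section \<open>Averaging over the assignments\<close>

text \<open>Privacy over \<open>k * b\<close> edges loses a factor \<open>E ^ k\<close> with
  \<open>E = exp (\<epsilon> * b)\<close>, while each output on the instance of empty sets hits half
  of the blocks for at most a fraction \<open>(2 / s) ^ k\<close> of the functions, where
  \<open>s = sqrt (m / k)\<close>. The assumption \<open>4 * E \<le> s\<close> makes the product at
  most \<open>1 / 2\<close>.\<close>

lemma edge_dp_half_coverage:
  fixes U :: "'a set"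
  assumes U: "finite U" "k * b \<le> card U"
    and k: "1 \<le> k" "k \<le> m"
    and alg: "max_cover_algorithm U k M" and dp: "edge_dp U \<epsilon> M"
    and eb: "4 * exp (\<epsilon> * real b) \<le> sqrt (real m / real k)"
  obtains S where "max_cover_instance U k S" "length S = m" "k * b \<le> OPT k S"
    "1 / 2 \<le> measure_pmf.prob (M S) {I. 2 * coverage S I \<le> k * b}"
proof -
  obtain V p where Vp: "V \<subseteq> U" "p ` V \<subseteq> {..<k}"
      and fibre: "\<And>j. j < k \<Longrightarrow> card {x \<in> V. p x = j} = b"
    using obtain_equal_blocks[OF U] by metis
  have finV: "finite V"
    using Vp U finite_subset by auto
  have cardV: "card V = k * b"
    using card_preimage_equal_blocks[OF finV Vp(2) fibre, of "\<lambda>_. True"] by simp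
  define F where "F = {..<k} \<rightarrow>\<^sub>E {..<m}"
  define S where "S f = assignment_system m V (f \<circ> p)" for f
  define hits where "hits f J = card {j. j < k \<and> f j \<in> J}" for f :: "nat \<Rightarrow> nat" and J
  define Y where "Y f = {J. k \<le> 2 * hits f J}" for f
  \<comment> \<open>This is the largest \<open>s\<close> that the counting bound admits for outputs
    of \<open>k\<close> indices.\<close>
  define s where "s = sqrt (real m / real k)"
  define E where "E = exp (\<epsilon> * real b)"
  have s2: "real k * s\<^sup>2 = real m" and s1: "1 \<le> s" and Es: "4 * E \<le> s"
    using k eb by (auto simp: s_def E_def real_sqrt_ge_1_iff)
  have finF: "finite F" and cardF: "card F = m ^ k"
    by (auto simp: F_def finite_PiE card_PiE)
  have range: "(f \<circ> p) ` V \<subseteq> {..<m}" "card ((f \<circ> p) ` V) \<le> k" if "f \<in> F" for f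
  proof -
    show "(f \<circ> p) ` V \<subseteq> {..<m}"
      using that Vp by (auto simp: F_def)
    have "card ((f \<circ> p) ` V) \<le> card (f ` {..<k})"
      using Vp by (intro card_mono) auto
    also have "\<dots> \<le> k"
      using card_image_le[of "{..<k}" f] by simp
    finally show "card ((f \<circ> p) ` V) \<le> k" .
  qed
  have inst: "max_cover_instance U k (S f)" for f
    using k Vp by (simp add: max_cover_instance_def S_def set_system_assignment_system)
  have inst0: "max_cover_instance U k (replicate m {})"
    using k by (simp add: max_cover_instance_def set_system_def)
  have coverage_S: "coverage (S f) J = b * hits f J" if "J \<subseteq> {..<m}" for f J
    using card_preimage_equal_blocks[OF finV Vp(2) fibre, of "\<lambda>j. f j \<in> J"] that
    by (simp add: S_def coverage_assignment_system hits_def)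

  \<comment> \<open>Restricting to the support guarantees that \<open>J\<close> consists of
    \<open>k\<close> valid indices.\<close>
  have few: "(\<Sum>f\<in>F. indicator (Y f) J) \<le> real m ^ k * (2 / s) ^ k"
    if "J \<in> set_pmf (M (replicate m {}))" for J
  proof -
    have "J \<in> k_choices k (replicate m ({} :: 'a set))"
      using alg inst0 that by (auto simp: max_cover_algorithm_def)
    then have J: "J \<subseteq> {..<m}" "card J = k"
      by (auto simp: k_choices_def)
    have "(\<Sum>f\<in>F. indicator (Y f) J) = real (card {f \<in> F. k \<le> 2 * hits f J})"
      using finF by (simp add: indicator_def Y_def sum.If_cases Int_def)
    also have "\<dots> \<le> (2 * real m) ^ k / s ^ k"
      using card_functions_hitting_half[of J m s k] J s1 s2
      by (simp add: F_def hits_def field_simps)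
    also have "\<dots> = real m ^ k * (2 / s) ^ k"
      by (simp add: power_mult_distrib power_divide)
    finally show ?thesis .
  qed

  have "(\<Sum>f\<in>F. measure_pmf.prob (M (S f)) (Y f))
      \<le> (\<Sum>f\<in>F. E ^ k * measure_pmf.prob (M (replicate m {})) (Y f))"
  proof (rule sum_mono)
    fix f assume "f \<in> F"
    have "exp (\<epsilon> * real (card V)) = E ^ k"
      by (simp add: E_def cardV exp_of_nat_mult[symmetric] algebra_simps)
    then show "measure_pmf.prob (M (S f)) (Y f)
        \<le> E ^ k * measure_pmf.prob (M (replicate m {})) (Y f)"
      using edge_dp_assignment_system[OF dp finV Vp(1) range(1)[OF \<open>f \<in> F\<close>]]
      by (simp add: S_def)
  qed
  \<comment> \<open>Exchanging sum and expectation reduces the average over \<open>f\<close> to the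
    pointwise count \<open>few\<close>.\<close>
  also have "\<dots> = E ^ k * measure_pmf.expectation (M (replicate m {}))
      (\<lambda>J. \<Sum>f\<in>F. indicator (Y f) J)"
    by (subst Bochner_Integration.integral_sum) (simp_all add: sum_distrib_left less_top[symmetric])
  also have "\<dots> \<le> E ^ k * (real m ^ k * (2 / s) ^ k)"
  proof (rule mult_left_mono)
    have "AE J in measure_pmf (M (replicate m {})).
        (\<Sum>f\<in>F. indicator (Y f) J) \<le> real m ^ k * (2 / s) ^ k"
      using few by (auto simp: AE_measure_pmf_iff)
    then show "measure_pmf.expectation (M (replicate m {})) (\<lambda>J. \<Sum>f\<in>F. indicator (Y f) J)
        \<le> real m ^ k * (2 / s) ^ k"
      by (intro measure_pmf.integral_le_const Bochner_Integration.integrable_sum)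
        (auto simp: less_top[symmetric])
  qed (simp add: E_def)
  also have "\<dots> = real m ^ k * (2 * E / s) ^ k"
    by (simp add: power_mult_distrib power_divide)
  also have "\<dots> \<le> real m ^ k * (1 / 2)"
  proof (rule mult_left_mono)
    have "(2 * E / s) ^ k \<le> (1 / 2) ^ k"
      using s1 Es by (intro power_mono) (auto simp: field_simps E_def)
    also have "\<dots> \<le> (1 / 2) ^ 1"
      using k by (intro power_decreasing) auto
    finally show "(2 * E / s) ^ k \<le> 1 / 2" by simp
  qed simp
  also have "\<dots> = (\<Sum>f\<in>F. 1 / 2)"
    by (simp add: cardF)
  finally have sum_le: "(\<Sum>f\<in>F. measure_pmf.prob (M (S f)) (Y f)) \<le> (\<Sum>f\<in>F. 1 / 2)" .
  \<comment> \<open>If every \<open>f\<close> had probability above \<open>1 / 2\<close>, the sum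
    over the nonempty \<open>F\<close> would exceed \<open>card F / 2\<close>.\<close>
  have "F \<noteq> {}"
    using k cardF by auto
  then obtain f where f: "f \<in> F" "measure_pmf.prob (M (S f)) (Y f) \<le> 1 / 2"
    using sum_le sum_strict_mono[OF finF, of "\<lambda>_. 1 / 2" "\<lambda>f. measure_pmf.prob (M (S f)) (Y f)"]
    by (meson not_le)

  \<comment> \<open>Outputs outside \<open>Y f\<close> hit fewer than half of the blocks, and each
    block hit contributes its \<open>b\<close> elements.\<close>
  have "1 / 2 \<le> measure_pmf.prob (M (S f)) (- Y f)"
    using f(2) measure_pmf.prob_compl[of "Y f" "M (S f)"] by (simp add: Compl_eq_Diff_UNIV)
  also have "\<dots> \<le> measure_pmf.prob (M (S f)) {I. 2 * coverage (S f) I \<le> k * b}"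
  proof (rule measure_pmf.finite_measure_mono_AE)
    have "2 * coverage (S f) J \<le> k * b" if "J \<in> set_pmf (M (S f))" "J \<notin> Y f" for J
    proof -
      have "J \<in> k_choices k (S f)"
        using alg inst that by (auto simp: max_cover_algorithm_def)
      then have "coverage (S f) J = b * hits f J"
        by (intro coverage_S) (auto simp: k_choices_def S_def)
      then show ?thesis
        using that by (simp add: Y_def)
    qed
    then show "AE J in measure_pmf (M (S f)).
        J \<in> - Y f \<longrightarrow> J \<in> {I. 2 * coverage (S f) I \<le> k * b}"
      by (auto simp: AE_measure_pmf_iff)
  qed simp
  finally have half: "1 / 2 \<le> measure_pmf.prob (M (S f)) {I. 2 * coverage (S f) I \<le> k * b}" .
  have "k * b \<le> OPT k (S f)" "length (S f) = m"
    using card_le_OPT_assignment_system[OF range[OF f(1)] k(2)] by (simp_all add: S_def cardV)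
  then show thesis
    using that[OF inst] half by simp
qed

section \<open>Choice of parameters and the lower bound\<close>

text \<open>The summand \<open>1\<close> in \<open>b\<close> keeps the blocks nonempty when \<open>\<epsilon>\<close> is large; it is paid for by the
  factor \<open>exp (2 * \<epsilon>)\<close> in the number \<open>m\<close> of sets.\<close>

lemma block_parameters:
  fixes n k :: nat and \<epsilon> :: real
  assumes "1 \<le> k" "k \<le> n" "0 < \<epsilon>"
  obtains b m :: nat where "k * b \<le> n" "k \<le> m"
    "4 * exp (\<epsilon> * real b) \<le> sqrt (real m / real k)"
    "real m \<le> 17 * real n * exp (17 * \<epsilon>)"
    "1 / 4 * min (real n) (real k * ln (real n / real k) / \<epsilon>) \<le> real k * real b / 2"
proof -
  define r where "r = real n / real k"
  \<comment> \<open>The solution of \<open>exp (\<epsilon> * y) = sqrt r\<close>.\<close>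
  define y where "y = ln r / (2 * \<epsilon>)"
  define b where "b = min (n div k) (nat \<lfloor>y\<rfloor> + 1)"
  \<comment> \<open>The factor 16 is the square of the 4 in the bound required of
    \<open>exp (\<epsilon> * real b)\<close>.\<close>
  define m where "m = nat \<lceil>16 * real n * exp (2 * \<epsilon>)\<rceil>"
  have r: "1 \<le> r" and n: "real n = real k * r"
    using assms by (auto simp: r_def field_simps)
  have y: "0 \<le> y"
    using r assms by (simp add: y_def)
  have m: "16 * real n * exp (2 * \<epsilon>) \<le> real m" "real m \<le> 16 * real n * exp (2 * \<epsilon>) + 1"
    unfolding m_def by (auto simp: of_nat_ceiling)
  have n_le: "real n \<le> real n * exp (2 * \<epsilon>)"
    using assms by (simp add: mult_le_cancel_left1)
  show thesis
  proof (rule that)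
    have "k * b \<le> k * (n div k)"
      by (simp add: b_def)
    also have "\<dots> \<le> n" by simp
    finally show "k * b \<le> n" .
    show "k \<le> m"
      using m(1) n_le assms by linarith
    have "real b \<le> real (nat \<lfloor>y\<rfloor> + 1)"
      by (simp only: b_def of_nat_le_iff min.cobounded2)
    also have "\<dots> \<le> 1 + y"
      using y by linarith
    finally have "\<epsilon> * real b \<le> \<epsilon> * (1 + y)"
      using assms by (intro mult_left_mono) auto
    also have "\<dots> = \<epsilon> + ln r / 2"
      using assms by (simp add: y_def field_simps)
    finally have "4 * exp (\<epsilon> * real b) \<le> 4 * exp (\<epsilon> + ln r / 2)"
      by simp
    also have "\<dots> = sqrt (16 * r * exp (2 * \<epsilon>))"
    proof (rule real_sqrt_unique[symmetric])
      show "(4 * exp (\<epsilon> + ln r / 2))\<^sup>2 = 16 * r * exp (2 * \<epsilon>)"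
        using r by (simp add: power_mult_distrib exp_double[symmetric] exp_add)
    qed simp
    also have "\<dots> \<le> sqrt (real m / real k)"
      using m(1) assms by (simp add: n field_simps)
    finally show "4 * exp (\<epsilon> * real b) \<le> sqrt (real m / real k)" .
    \<comment> \<open>Rounding up adds at most 1, which turns 16 into 17. The exponent is relaxed to
      17 as well, so that one constant serves in both places.\<close>
    have "real m \<le> 17 * (real n * exp (2 * \<epsilon>))"
      using m(2) n_le assms by linarith
    also have "\<dots> \<le> 17 * (real n * exp (17 * \<epsilon>))"
      using assms by (intro mult_left_mono) auto
    finally show "real m \<le> 17 * real n * exp (17 * \<epsilon>)" by simp
    \<comment> \<open>Since \<open>1 \<le> n div k\<close>, the remainder is below
      \<open>k * (n div k)\<close>, so the cap on \<open>b\<close> loses at most a factor 2.\<close>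
    have "real n \<le> 2 * (real k * real (n div k))"
    proof -
      have "n = k * (n div k) + n mod k" "n mod k < k" "1 \<le> n div k"
        using assms by (auto simp: div_greater_zero_iff Suc_le_eq)
      then have "n \<le> 2 * (k * (n div k))"
        by (smt (verit) add_le_cancel_left less_imp_le_nat mult_2 mult_le_mono2 nat_mult_1_right order_trans)
      then show ?thesis
        by (metis of_nat_le_iff of_nat_mult of_nat_numeral)
    qed
    moreover have "y \<le> real (nat \<lfloor>y\<rfloor> + 1)"
      using y by linarith
    then have "real k * y \<le> real k * real (nat \<lfloor>y\<rfloor> + 1)"
      by (rule mult_left_mono) simp
    moreover have "real k * ln r / \<epsilon> = 2 * (real k * y)"
      using assms by (simp add: y_def)
    \<comment> \<open>If the cap is attained, \<open>k * b\<close> is at least \<open>n / 2\<close>;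
      otherwise \<open>b\<close> is at least \<open>y\<close>. Either way \<open>k * b\<close> is at
      least half of the minimum.\<close>
    ultimately show "1 / 4 * min (real n) (real k * ln (real n / real k) / \<epsilon>)
        \<le> real k * real b / 2"
      unfolding r_def[symmetric] by (cases "n div k \<le> nat \<lfloor>y\<rfloor> + 1") (auto simp: b_def min_def)
  qed
qed

text \<open>No error exceeds \<open>n\<close>, hence the minimum with \<open>n\<close>. The bound on
  \<open>length S\<close> shows that, for bounded \<open>\<epsilon>\<close>, hard instances with at
  most linearly many sets in \<open>n\<close> suffice.\<close>

theorem theorem1p4:
  shows "\<exists>c > 0. \<exists>C > 0. \<forall>(n::nat) (k::nat) (\<epsilon>::real) (U::nat set) (M :: nat set list \<Rightarrow> nat set pmf).
    1 \<le> k \<longrightarrow> k \<le> n \<longrightarrow> 0 < \<epsilon> \<longrightarrow> finite U \<longrightarrow> card U = n \<longrightarrow>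
    max_cover_algorithm U k M \<longrightarrow> edge_dp U \<epsilon> M \<longrightarrow>
    (\<exists>S. max_cover_instance U k S \<and>
         real (length S) \<le> C * real n * exp (C * \<epsilon>) \<and>
         measure_pmf.prob (M S)
           {I. real (coverage S I) \<le>
               real (OPT k S) - c * min (real n) (real k * ln (real n / real k) / \<epsilon>)} \<ge> 1 / 2)"
proof (rule exI[of _ "1 / 4"], intro conjI, simp, rule exI[of _ 17], intro conjI, simp,
    intro allI impI)
  fix n k :: nat and \<epsilon> :: real and U :: "nat set" and M :: "nat set list \<Rightarrow> nat set pmf"
  assume k: "1 \<le> k" "k \<le> n" and \<epsilon>: "0 < \<epsilon>" and U: "finite U" "card U = n"
    and M: "max_cover_algorithm U k M" "edge_dp U \<epsilon> M"
  let ?err = "1 / 4 * min (real n) (real k * ln (real n / real k) / \<epsilon>)"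
  obtain b m where bm: "k * b \<le> n" "k \<le> m"
      "4 * exp (\<epsilon> * real b) \<le> sqrt (real m / real k)"
      "real m \<le> 17 * real n * exp (17 * \<epsilon>)" and err: "?err \<le> real k * real b / 2"
    by (rule block_parameters[OF k \<epsilon>])
  have "k * b \<le> card U"
    using bm U by simp
  then obtain S where S: "max_cover_instance U k S" "length S = m" "k * b \<le> OPT k S"
      "1 / 2 \<le> measure_pmf.prob (M S) {I. 2 * coverage S I \<le> k * b}"
    by (rule edge_dp_half_coverage[OF U(1) _ k(1) bm(2) M bm(3)])
  \<comment> \<open>The optimum is at least \<open>k * b\<close>, so covering at most half of that
    loses at least \<open>k * b / 2\<close>.\<close>
  have "real (coverage S I) \<le> real (OPT k S) - ?err" if "2 * coverage S I \<le> k * b" for I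
  proof -
    have "2 * real (coverage S I) \<le> real (k * b)" "real (k * b) \<le> real (OPT k S)"
      using that S(3) by linarith+
    then show ?thesis
      using err by simp
  qed
  then have "measure_pmf.prob (M S) {I. 2 * coverage S I \<le> k * b}
      \<le> measure_pmf.prob (M S) {I. real (coverage S I) \<le> real (OPT k S) - ?err}"
    by (intro measure_pmf.finite_measure_mono) auto
  then show "\<exists>S. max_cover_instance U k S \<and>
      real (length S) \<le> 17 * real n * exp (17 * \<epsilon>) \<and>
      1 / 2 \<le> measure_pmf.prob (M S) {I. real (coverage S I) \<le> real (OPT k S) - ?err}"
    using S bm(4) by (intro exI[of _ S] conjI) simp_all
qed

end
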